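(* Let $0<p<1$ and let $r,s$ be real numbers satisfying either $s<r\le -\frac1p$ or $0<s<r<\frac1p$. Define $$C_{p,r,s}=\begin{cases}2^{(r-s)p} & \text{if } s<r\le-\frac1p,\\[2pt] \dfrac{1-sp}{1-rp} & \text{if } 0<s<r<\frac1p.\end{cases}$$ Then for every sequence $(a_n)_{n\ge1}$ of non-negative reals, $$\sum_{n=1}^{\infty}\left(n^{-r}\sum_{k=n}^{\infty}\frac{a_k}{(k+1)^{1-r}}\right)^p\le C_{p,r,s}\sum_{n=1}^{\infty}\left(n^{-s}\sum_{k=n}^{\infty}\frac{a_k}{(k+1)^{1-s}}\right)^p .$$ The constant $C_{p,r,s}$ is best possible, i.e. for each such $p,r,s$ it cannot be replaced by any smaller constant for which the inequality holds for all non-negative sequences $(a_n)$.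
   Context: All sums of non-negative terms are understood as elements of $[0,\infty]$, with $\infty^p=\infty$. *)

theory Defs
  imports "HOL-Analysis.Analysis"
begin

(* x^p on [0,\<infinity>], meant for p > 0: \<infinity>^p = \<infinity>, and 0^p = 0 since 0 powr p = 0. *)
definition ennpowr :: "ennreal \<Rightarrow> real \<Rightarrow> ennreal" where
  "ennpowr x p = (if x = \<infinity> then \<infinity> else ennreal (enn2real x powr p))"

(* Both sides of the inequality are values of this sum, with t = r and t = s. Sums are infsum over
   ennreal, where every family is summable. Only the values a k with k \<ge> 1 are used. *)
definition copson_sum :: "real \<Rightarrow> real \<Rightarrow> (nat \<Rightarrow> real) \<Rightarrow> ennreal" where
  "copson_sum p t a =
    (\<Sum>\<^sub>\<infinity>n\<in>{1..}. ennpowr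
      (ennreal (real n powr (- t)) * (\<Sum>\<^sub>\<infinity>k\<in>{n..}. ennreal (a k / real (k + 1) powr (1 - t)))) p)"

(* The second branch is meant for 0 < s < r < 1/p; the two parameter ranges are disjoint for p > 0. *)
definition copson_const :: "real \<Rightarrow> real \<Rightarrow> real \<Rightarrow> real" where
  "copson_const p r s =
    (if s < r \<and> r \<le> - (1 / p) then 2 powr ((r - s) * p) else (1 - s * p) / (1 - r * p))"

end

theory Submission
  imports Defs
begin

text \<open>
  Put \<open>A\<^sub>n = \<Sum>\<^sub>k\<^sub>\<ge>\<^sub>n a\<^sub>k (k+1)\<^sup>s\<^sup>-\<^sup>1\<close>. The inner sum on the left is
  \<open>\<Sum>\<^sub>k\<^sub>\<ge>\<^sub>n (k+1)\<^sup>r\<^sup>-\<^sup>s (A\<^sub>k - A\<^sub>k\<^sub>+\<^sub>1)\<close>, and concavity of \<open>x\<^sup>p\<close> bounds its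
  \<open>p\<close>-th power by the same expression with \<open>A\<close> and the weights replaced by their \<open>p\<close>-th powers.
  The resulting inequality is linear in the nonnegative decrements of \<open>A\<^sup>p\<close>, so it only has to be
  checked for sequences \<open>a\<close> supported at one point \<open>m\<close>, where it is a comparison of two power sums.
  Hence the best constant is the supremum over \<open>m\<close> of the ratio of these power sums: it is attained
  at \<open>m = 1\<close> if \<open>r \<le> -1/p\<close>, and it is the limit \<open>m \<rightarrow> \<infinity>\<close> if \<open>0 < s\<close>.
\<close>

section \<open>Concavity and the reduction to sequences supported at one point\<close>

lemma powr_increment_antimono:
  fixes p d y T :: real
  assumes "0 < p" "p \<le> 1" "0 \<le> d" "0 \<le> y" "y \<le> T"
  shows "(T + d) powr p - T powr p \<le> (y + d) powr p - y powr p"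
\<comment> \<open>The open-interval criterion is chosen because y = 0 is allowed, where
  \<open>z powr p\<close> need not be differentiable.\<close>
proof (rule DERIV_nonpos_imp_decreasing_open[OF \<open>y \<le> T\<close>, where f = "\<lambda>z. (z + d) powr p - z powr p"])
  fix x assume "y < x" "x < T"
  then have "x > 0" using assms by simp
  have "((\<lambda>z. (z + d) powr p - z powr p) has_real_derivative
         p * (x + d) powr (p - 1) - p * x powr (p - 1)) (at x)"
    using \<open>x > 0\<close> assms by (auto intro!: derivative_eq_intros)
  moreover have "(x + d) powr (p - 1) \<le> x powr (p - 1)"
    using \<open>x > 0\<close> assms by (intro powr_mono2') auto
  ultimately show "\<exists>D. ((\<lambda>z. (z + d) powr p - z powr p) has_real_derivative D) (at x) \<and> D \<le> 0"
    using assms by (auto intro!: exI mult_left_mono)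
next
  show "continuous_on {y..T} (\<lambda>z. (z + d) powr p - z powr p)"
    using assms by (intro continuous_intros continuous_on_powr') auto
qed

text \<open>Bernoulli's inequality for exponents in [0,1]: weighted AM-GM for the numbers 1 + x and
  1 with weights d and 1 - d.\<close>

lemma powr_one_plus_le:
  fixes x d :: real
  assumes "0 \<le> d" "d \<le> 1" "-1 < x"
  shows "(1 + x) powr d \<le> 1 + d * x"
  using Youngs_inequality_0[of d "1 - d" "1 + x" 1] assms by (simp add: algebra_simps)

text \<open>Downward induction from n = N + 1; the first two conjuncts are carried along for the
  third. Write T(n) for the weighted sum. As c increases, T(n+1) is at least c(n) A(n+1). By
  concavity, adding c(n) (A(n) - A(n+1)) to T(n+1) therefore raises the p-th power by no more than
  adding it to c(n) A(n+1), where the gain is exactly c(n)^p (A(n)^p - A(n+1)^p).\<close>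

lemma sum_weighted_decrements_powr:
  fixes A c :: "nat \<Rightarrow> real"
  assumes p: "0 < p" "p \<le> 1"
    and A: "\<And>k. n \<le> k \<Longrightarrow> k \<le> N \<Longrightarrow> A (Suc k) \<le> A k" "A (Suc N) = 0"
    and c: "\<And>k. 0 \<le> c k" "\<And>k. c k \<le> c (Suc k)"
    and n: "n \<le> Suc N"
  shows "c n * A n \<le> (\<Sum>k=n..N. c k * (A k - A (Suc k))) \<and> 0 \<le> A n \<and>
         (\<Sum>k=n..N. c k * (A k - A (Suc k))) powr p
           \<le> (\<Sum>k=n..N. c k powr p * (A k powr p - A (Suc k) powr p))"
  using n A(1)
proof (induction rule: inc_induct)
  case base
  then show ?case using A(2) p by simp
next
  case (step n)
  let ?T = "\<lambda>n. \<Sum>k=n..N. c k * (A k - A (Suc k))"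
  let ?U = "\<lambda>n. \<Sum>k=n..N. c k powr p * (A k powr p - A (Suc k) powr p)"
  have IH: "c (Suc n) * A (Suc n) \<le> ?T (Suc n)" "0 \<le> A (Suc n)" "?T (Suc n) powr p \<le> ?U (Suc n)"
    using step.IH step.prems by auto
  have An: "A (Suc n) \<le> A n" using step.prems step.hyps by simp
  have T: "?T n = c n * (A n - A (Suc n)) + ?T (Suc n)"
    and U: "?U n = c n powr p * (A n powr p - A (Suc n) powr p) + ?U (Suc n)"
    using step.hyps by (simp_all add: sum.atLeast_Suc_atMost)
  have le: "c n * A (Suc n) \<le> ?T (Suc n)"
    using IH(1) mult_right_mono[OF c(2) IH(2), of n] by linarith
  have d: "0 \<le> c n * (A n - A (Suc n))" using c An by simp
  have "(?T (Suc n) + c n * (A n - A (Suc n))) powr p - ?T (Suc n) powr p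
        \<le> (c n * A (Suc n) + c n * (A n - A (Suc n))) powr p - (c n * A (Suc n)) powr p"
    using p d le c(1) IH(2) by (intro powr_increment_antimono) auto
  also have "\<dots> = c n powr p * (A n powr p - A (Suc n) powr p)"
    using c(1)[of n] IH(2) An by (simp add: algebra_simps flip: powr_mult)
  finally have "?T n powr p \<le> ?U n"
    using IH(3) T U by (simp add: add.commute)
  moreover have "c n * A n \<le> ?T n" using T le by (simp add: algebra_simps)
  ultimately show ?case using An IH(2) by simp
qed

lemma sum_triangle_swap:
  fixes f :: "nat \<Rightarrow> nat \<Rightarrow> 'a::comm_monoid_add"
  shows "(\<Sum>n=1..N. \<Sum>k=n..N. f n k) = (\<Sum>k=1..N. \<Sum>n=1..k. f n k)"
  by (simp add: sum.Sigma)
     (rule sum.reindex_bij_witness[of _ "\<lambda>(k, n). (n, k)" "\<lambda>(n, k). (k, n)"], auto)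

text \<open>The hypothesis on C is the inequality for the sequence supported at m, with the common
  factor (m+1)^((s-1)p) cancelled.\<close>

lemma copson_finite:
  fixes a :: "nat \<Rightarrow> real"
  assumes p: "0 < p" "p \<le> 1" and "s \<le> r" and a: "\<And>n. 1 \<le> n \<Longrightarrow> 0 \<le> a n"
    and C: "\<And>m. 1 \<le> m \<Longrightarrow> real (m + 1) powr ((r - s) * p) * (\<Sum>n=1..m. real n powr (- r * p))
                 \<le> C * (\<Sum>n=1..m. real n powr (- s * p))"
  shows "(\<Sum>n=1..N. (real n powr (- r) * (\<Sum>k=n..N. a k / real (k + 1) powr (1 - r))) powr p)
    \<le> C * (\<Sum>n=1..N. (real n powr (- s) * (\<Sum>k=n..N. a k / real (k + 1) powr (1 - s))) powr p)"
proof -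
  \<comment> \<open>Cutting the inner sums at N makes \<open>A (Suc N) = 0\<close>, so that the
    telescoping sums have no boundary term.\<close>
  define A where "A n = (\<Sum>k=n..N. a k / real (k + 1) powr (1 - s))" for n
  define c where "c k = real (k + 1) powr (r - s)" for k :: nat
  define B where "B k = A k powr p - A (Suc k) powr p" for k
  have Adiff: "A k - A (Suc k) = a k / real (k + 1) powr (1 - s)" if "k \<le> N" for k
    using that by (simp add: A_def sum.atLeast_Suc_atMost)
  have Amono: "A (Suc k) \<le> A k" if "1 \<le> k" "k \<le> N" for k
    using Adiff[of k] a[of k] that by (smt (verit) divide_nonneg_nonneg powr_ge_zero)
  have A0: "A (Suc N) = 0" by (simp add: A_def)
  have Anonneg: "0 \<le> A n" if "1 \<le> n" for n
    unfolding A_def using a that by (intro sum_nonneg divide_nonneg_nonneg) auto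
  have B0: "0 \<le> B k" if "1 \<le> k" "k \<le> N" for k
    unfolding B_def using Amono[of k] Anonneg[of "Suc k"] that p by (simp add: powr_mono2)
  have cp: "c k powr p = real (k + 1) powr ((r - s) * p)" for k
    by (simp add: c_def powr_powr)
  have T: "(\<Sum>k=n..N. a k / real (k + 1) powr (1 - r)) = (\<Sum>k=n..N. c k * (A k - A (Suc k)))" for n
  proof (rule sum.cong)
    fix k assume "k \<in> {n..N}"
    then have "c k * (A k - A (Suc k)) = real (k + 1) powr (r - s) * (a k / real (k + 1) powr (1 - s))"
      using Adiff[of k] by (simp add: c_def)
    also have "\<dots> = a k / real (k + 1) powr (1 - r)"
      by (simp add: powr_diff)
    finally show "a k / real (k + 1) powr (1 - r) = c k * (A k - A (Suc k))" ..
  qed simp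
  have "(\<Sum>n=1..N. (real n powr (- r) * (\<Sum>k=n..N. a k / real (k + 1) powr (1 - r))) powr p)
      \<le> (\<Sum>n=1..N. real n powr (- r * p) * (\<Sum>k=n..N. c k powr p * B k))"
  proof (rule sum_mono)
    fix n assume n: "n \<in> {1..N}"
    have "(\<Sum>k=n..N. c k * (A k - A (Suc k))) powr p \<le> (\<Sum>k=n..N. c k powr p * B k)"
      using sum_weighted_decrements_powr[of p n N A c] n p Amono A0 \<open>s \<le> r\<close>
      by (simp add: c_def powr_mono2 B_def)
    moreover have "0 \<le> (\<Sum>k=n..N. c k * (A k - A (Suc k)))"
      using n Amono by (intro sum_nonneg mult_nonneg_nonneg) (auto simp: c_def)
    ultimately show "(real n powr (- r) * (\<Sum>k=n..N. a k / real (k + 1) powr (1 - r))) powr p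
        \<le> real n powr (- r * p) * (\<Sum>k=n..N. c k powr p * B k)"
      unfolding T by (simp add: powr_mult powr_powr mult_left_mono)
  qed
  \<comment> \<open>With the decrement \<open>B k\<close> outermost, its coefficient is a power sum
    up to k, and the hypothesis on C at m = k applies term by term.\<close>
  also have "\<dots> = (\<Sum>k=1..N. B k * (c k powr p * (\<Sum>n=1..k. real n powr (- r * p))))"
    by (simp add: sum_distrib_left sum_triangle_swap[simplified] mult_ac)
  also have "\<dots> \<le> (\<Sum>k=1..N. B k * (C * (\<Sum>n=1..k. real n powr (- s * p))))"
    using C B0 cp by (intro sum_mono mult_left_mono) auto
  also have "\<dots> = C * (\<Sum>n=1..N. real n powr (- s * p) * (\<Sum>k=n..N. B k))"
    by (simp add: sum_distrib_left sum_distrib_right sum_triangle_swap[simplified] mult_ac)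
  also have "\<dots> = C * (\<Sum>n=1..N. (real n powr (- s) * A n) powr p)"
  proof -
    have "(\<Sum>k=n..N. B k) = A n powr p" if "n \<in> {1..N}" for n
      using sum_Suc_diff[of n N "\<lambda>k. - (A k powr p)"] that A0 p by (simp add: B_def)
    then show ?thesis
      using Anonneg by (simp add: powr_mult powr_powr)
  qed
  finally show ?thesis unfolding A_def .
qed

section \<open>Comparison of power sums\<close>

text \<open>
  The points \<open>2n/(m+1)\<close>, \<open>1 \<le> n \<le> m\<close>, have mean 1, so the tangent line of
  \<open>x\<^sup>\<beta> - x\<^sup>\<alpha>\<close> at 1, which lies below the graph, sums to 0.
\<close>
lemma power_sum_ratio_le_two_powr:
  fixes \<alpha> \<beta> :: real
  assumes "1 \<le> \<alpha>" "\<alpha> \<le> \<beta>"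
  shows "real (m + 1) powr (\<beta> - \<alpha>) * (\<Sum>n=1..m. real n powr \<alpha>)
           \<le> 2 powr (\<beta> - \<alpha>) * (\<Sum>n=1..m. real n powr \<beta>)"
proof -
  have tangent: "(\<beta> - \<alpha>) * (x - 1) \<le> x powr \<beta> - x powr \<alpha>" if "0 < x" for x :: real
  proof -
    have "x - 1 \<le> x * ln x"
      using mult_left_mono[OF ln_le_minus_one[of "inverse x"], of x] that
      by (simp add: ln_inverse right_diff_distrib)
    \<comment> \<open>Since \<alpha> is at least 1, x^\<alpha> - x has the same sign as ln x. This
      is where the condition r \<le> -1/p enters, through \<alpha> = -rp.\<close>
    also have "\<dots> \<le> x powr \<alpha> * ln x"
    proof (cases "1 \<le> x")
      case True
      then show ?thesis using powr_mono[of 1 \<alpha> x] assms by (simp add: mult_right_mono)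
    next
      case False
      then show ?thesis using powr_mono'[of 1 \<alpha> x] assms that
        by (intro mult_right_mono_neg) (auto simp: ln_le_zero_iff)
    qed
    finally have "(\<beta> - \<alpha>) * (x - 1) \<le> x powr \<alpha> * ((\<beta> - \<alpha>) * ln x)"
      using assms mult_left_mono[of "x - 1" "x powr \<alpha> * ln x" "\<beta> - \<alpha>"] by (simp add: mult_ac)
    also have "\<dots> \<le> x powr \<alpha> * (x powr (\<beta> - \<alpha>) - 1)"
    proof (rule mult_left_mono)
      show "(\<beta> - \<alpha>) * ln x \<le> x powr (\<beta> - \<alpha>) - 1"
        using ln_le_minus_one[of "x powr (\<beta> - \<alpha>)"] that by (simp add: ln_powr)
    qed simp
    also have "\<dots> = x powr \<beta> - x powr \<alpha>"
      by (simp add: right_diff_distrib flip: powr_add)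
    finally show ?thesis .
  qed
  let ?x = "\<lambda>n::nat. real n * (2 / real (m + 1))"
  have "(\<Sum>n=1..m. ?x n) = real m"
  proof -
    have "(\<Sum>n=1..m. real n) = real m * (real m + 1) / 2"
      by (induction m) (auto simp: field_simps)
    then show ?thesis
      unfolding sum_distrib_right[symmetric] by (simp add: divide_simps)
  qed
  then have "0 = (\<Sum>n=1..m. (\<beta> - \<alpha>) * (?x n - 1))"
    by (simp add: sum_subtractf flip: sum_distrib_left)
  also have "\<dots> \<le> (\<Sum>n=1..m. ?x n powr \<beta> - ?x n powr \<alpha>)"
    by (intro sum_mono tangent) auto
  finally have le: "(2 / real (m + 1)) powr \<alpha> * (\<Sum>n=1..m. real n powr \<alpha>)
      \<le> (2 / real (m + 1)) powr \<beta> * (\<Sum>n=1..m. real n powr \<beta>)"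
    unfolding powr_mult sum_subtractf sum_distrib_right[symmetric] by (simp add: mult.commute)
  have "(real (m + 1) / 2) powr \<alpha> * (2 / real (m + 1)) powr \<alpha> = 1"
    "(real (m + 1) / 2) powr \<alpha> * (2 / real (m + 1)) powr \<beta> = (2 / real (m + 1)) powr (\<beta> - \<alpha>)"
    by (simp_all add: powr_divide powr_diff field_simps)
  then have "(\<Sum>n=1..m. real n powr \<alpha>) \<le> (2 / real (m + 1)) powr (\<beta> - \<alpha>) * (\<Sum>n=1..m. real n powr \<beta>)"
    using mult_left_mono[OF le, of "(real (m + 1) / 2) powr \<alpha>"] by (simp flip: mult.assoc)
  then show ?thesis by (simp add: powr_divide field_simps)
qed

text \<open>The right side is the integral of w x^(w-1) over [0,m]. In the induction, Bernoulli's
  inequality at -1/M with M = m + 1 gives (M-1)^w \<le> M^w - w M^(w-1).\<close>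

lemma mult_sum_powr_le:
  fixes w :: real
  assumes "0 < w" "w \<le> 1"
  shows "w * (\<Sum>n=1..m. real n powr (w - 1)) \<le> real m powr w"
proof (induction m)
  case (Suc m)
  have "real (Suc m) * (1 + (- 1 / real (Suc m))) = real m"
    unfolding distrib_left by simp
  then have "real m powr w = (real (Suc m) * (1 + (- 1 / real (Suc m)))) powr w"
    by simp
  also have "\<dots> = real (Suc m) powr w * (1 + (- 1 / real (Suc m))) powr w"
    by (rule powr_mult)
  also have "\<dots> \<le> real (Suc m) powr w * (1 + w * (- 1 / real (Suc m)))"
  \<comment> \<open>For m = 0 the Bernoulli argument is -1, which \<open>powr_one_plus_le\<close>
    excludes.\<close>
  proof (cases "m = 0")
    case False
    then show ?thesis using assms by (intro mult_left_mono powr_one_plus_le) auto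
  qed (use assms in auto)
  also have "\<dots> = real (Suc m) powr w - w * real (Suc m) powr (w - 1)"
    by (simp add: powr_diff field_simps)
  finally show ?case using Suc by (simp add: distrib_left)
qed auto

text \<open>The matching lower estimate, by the integral over [1,m+1]; Bernoulli's inequality is now
  used at 1/M. Both estimates together give the growth m^w needed for optimality.\<close>

lemma mult_sum_powr_ge:
  fixes w :: real
  assumes "0 < w" "w \<le> 1"
  shows "real (m + 1) powr w - 1 \<le> w * (\<Sum>n=1..m. real n powr (w - 1))"
proof (induction m)
  case (Suc m)
  have "real (Suc m) * (1 + 1 / real (Suc m)) = real (Suc m + 1)"
    unfolding distrib_left by simp
  then have "real (Suc m + 1) powr w = (real (Suc m) * (1 + 1 / real (Suc m))) powr w"
    by simp
  also have "\<dots> = real (Suc m) powr w * (1 + 1 / real (Suc m)) powr w"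
    by (rule powr_mult)
  also have "\<dots> \<le> real (Suc m) powr w * (1 + w * (1 / real (Suc m)))"
    using assms by (intro mult_left_mono powr_one_plus_le) (auto intro: less_le_trans[of _ 0])
  also have "\<dots> = real (Suc m) powr w + w * real (Suc m) powr (w - 1)"
    by (simp add: powr_diff field_simps)
  finally show ?case using Suc by (simp add: distrib_left)
qed auto

text \<open>Equivalently, w (m+1)^(-w) times the sum of n^(w-1) over n \<le> m is nondecreasing in w
  on (0,1]. In the induction step put M = m + 1. Bernoulli's inequality for (1 + 1/M)^(w'-w) leaves
  an error (w'-w) M^(w'-w-1) X, and X \<le> M^w bounds it by (w'-w) M^(w'-1). Added to the new term
  w M^(w'-1), this is exactly the increment w' M^(w'-1) of the right side.\<close>

lemma normalized_sum_powr_mono: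
  fixes w w' :: real
  assumes "0 < w" "w \<le> w'" "w' \<le> 1"
  shows "w * (\<Sum>n=1..m. real n powr (w - 1)) * real (m + 1) powr (w' - w)
           \<le> w' * (\<Sum>n=1..m. real n powr (w' - 1))"
proof (induction m)
  case (Suc m)
  define M where "M = real (Suc m)"
  have M: "0 < M" by (simp add: M_def)
  define X where "X = w * (\<Sum>n=1..Suc m. real n powr (w - 1))"
  have "0 \<le> X"
    unfolding X_def using assms by (intro mult_nonneg_nonneg sum_nonneg) auto
  moreover have "X \<le> M powr w"
    using mult_sum_powr_le[of w "Suc m"] assms unfolding X_def M_def by linarith
  ultimately have X: "0 \<le> X" "X \<le> M powr w" .
  have "M * (1 + 1 / M) = real (Suc m + 1)"
    unfolding distrib_left M_def by simp
  then have "real (Suc m + 1) powr (w' - w) = (M * (1 + 1 / M)) powr (w' - w)"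
    by simp
  also have "\<dots> = M powr (w' - w) * (1 + 1 / M) powr (w' - w)"
    by (rule powr_mult)
  also have "\<dots> \<le> M powr (w' - w) * (1 + (w' - w) * (1 / M))"
    using assms M by (intro mult_left_mono powr_one_plus_le) (auto intro: less_le_trans[of _ 0])
  finally have "X * real (Suc m + 1) powr (w' - w)
      \<le> X * (M powr (w' - w) * (1 + (w' - w) * (1 / M)))"
    using X by (intro mult_left_mono)
  also have "\<dots> = X * M powr (w' - w) + (w' - w) / M * M powr (w' - w) * X"
    by (simp add: algebra_simps)
  also have "\<dots> \<le> X * M powr (w' - w) + (w' - w) / M * M powr (w' - w) * M powr w"
    using X M assms by (intro add_left_mono mult_left_mono) auto
  also have "\<dots> = w * (\<Sum>n=1..m. real n powr (w - 1)) * real (m + 1) powr (w' - w)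
      + w' * M powr (w' - 1)"
  proof -
    have "X = w * (\<Sum>n=1..m. real n powr (w - 1)) + w * M powr (w - 1)"
      by (simp add: X_def M_def distrib_left)
    moreover have "M powr (w - 1) * M powr (w' - w) = M powr (w' - 1)"
      "M powr (w' - w) * M powr w = M powr (w' - 1) * M"
      using M by (simp_all add: powr_diff)
    moreover have "real (m + 1) = M" by (simp add: M_def)
    ultimately show ?thesis
      using M by (simp add: field_simps)
  qed
  also have "\<dots> \<le> w' * (\<Sum>n=1..Suc m. real n powr (w' - 1))"
    using Suc by (simp add: M_def distrib_left)
  finally show ?case unfolding X_def .
qed auto

section \<open>Passage to infinite sums in [0,\<infinity>]\<close>

lemma infsum_atLeast_ennreal_tendsto:
  fixes f :: "nat \<Rightarrow> real"
  assumes "\<And>k. n \<le> k \<Longrightarrow> 0 \<le> f k"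
  shows "(\<lambda>N. ennreal (\<Sum>k=n..N. f k)) \<longlonglongrightarrow> (\<Sum>\<^sub>\<infinity>k\<in>{n..}. ennreal (f k))"
proof -
  \<comment> \<open>\<open>infsum\<close> is a limit over all finite subsets; the segments
    \<open>{n..N}\<close> eventually contain each of them.\<close>
  have "filterlim (\<lambda>N. {n..N}) (finite_subsets_at_top {n..}) sequentially"
    unfolding filterlim_finite_subsets_at_top
  proof safe
    fix X assume "finite X" "X \<subseteq> {n..}"
    then show "\<forall>\<^sub>F N in sequentially. finite {n..N} \<and> X \<subseteq> {n..N} \<and> {n..N} \<subseteq> {n..}"
      by (intro eventually_sequentiallyI[of "Max X"]) (auto simp: subset_iff dest: Max_ge[of X] order_trans)
  qed
  moreover have "((\<lambda>k. ennreal (f k)) has_sum (\<Sum>\<^sub>\<infinity>k\<in>{n..}. ennreal (f k))) {n..}"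
    by (intro has_sum_infsum nonneg_summable_on_complete) simp
  ultimately have "(\<lambda>N. \<Sum>k=n..N. ennreal (f k)) \<longlonglongrightarrow> (\<Sum>\<^sub>\<infinity>k\<in>{n..}. ennreal (f k))"
    unfolding has_sum_def by (auto dest: filterlim_compose)
  moreover have "(\<Sum>k=n..N. ennreal (f k)) = ennreal (\<Sum>k=n..N. f k)" for N
    using assms by (intro sum_ennreal) auto
  ultimately show ?thesis by simp
qed

lemma ennpowr_ennreal [simp]: "0 \<le> x \<Longrightarrow> ennpowr (ennreal x) p = ennreal (x powr p)"
  by (simp add: ennpowr_def)

lemma ennpowr_mono:
  assumes "0 < p" "x \<le> y"
  shows "ennpowr x p \<le> ennpowr y p"
  using assms by (cases x; cases y) (auto simp: ennpowr_def powr_mono2 top_unique)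

lemma tendsto_ennpowr:
  assumes "0 < p" and X: "(\<lambda>N. ennreal (X N)) \<longlonglongrightarrow> x" and nonneg: "\<And>N::nat. 0 \<le> X N"
  shows "(\<lambda>N. ennreal (X N powr p)) \<longlonglongrightarrow> ennpowr x p"
proof (cases x)
  case (real y)
  then have "X \<longlonglongrightarrow> y"
    using X nonneg by (simp add: tendsto_ennreal_iff)
  then have "(\<lambda>N. X N powr p) \<longlonglongrightarrow> y powr p"
    using assms(1) by (auto intro!: tendsto_powr2 simp: nonneg)
  then show ?thesis
    using real by simp
next
  case top
  then have "filterlim X at_top sequentially"
    using X by (simp add: ennreal_tendsto_top_eq_at_top)
  have "filterlim (\<lambda>N. X N powr p) at_top sequentially"
    unfolding filterlim_at_top
  proof
    fix Z
    \<comment> \<open>The maximum with 0 keeps the base nonnegative, so that the powers 1/p and p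
      cancel.\<close>
    have "\<forall>\<^sub>F N in sequentially. max Z 0 powr (1 / p) \<le> X N"
      using \<open>filterlim X at_top sequentially\<close> by (simp add: filterlim_at_top)
    then show "\<forall>\<^sub>F N in sequentially. Z \<le> X N powr p"
    proof eventually_elim
      case (elim N)
      then have "(max Z 0 powr (1 / p)) powr p \<le> X N powr p"
        using \<open>0 < p\<close> by (intro powr_mono2) auto
      then show ?case
        using \<open>0 < p\<close> by (simp add: powr_powr)
    qed
  qed
  then show ?thesis
    using top by (simp add: ennpowr_def ennreal_tendsto_top_eq_at_top)
qed

text \<open>For inner sums cut at N this is \<open>copson_finite\<close>. On the s side the cut sums
  increase to the full ones and are bounded by them. On the r side only a finite set F of outer
  indices is kept while N tends to infinity, so limit and outer sum may be interchanged.\<close>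

lemma copson_sum_le:
  fixes a :: "nat \<Rightarrow> real"
  assumes p: "0 < p" "p \<le> 1" and "s \<le> r" and a: "\<And>n. 1 \<le> n \<Longrightarrow> 0 \<le> a n" and "0 \<le> C"
    and C: "\<And>m. 1 \<le> m \<Longrightarrow> real (m + 1) powr ((r - s) * p) * (\<Sum>n=1..m. real n powr (- r * p))
                 \<le> C * (\<Sum>n=1..m. real n powr (- s * p))"
  shows "copson_sum p r a \<le> ennreal C * copson_sum p s a"
proof -
  define S where "S t n N = real n powr (- t) * (\<Sum>k=n..N. a k / real (k + 1) powr (1 - t))"
    for t and n N :: nat
  define T where "T t n = ennreal (real n powr (- t)) * (\<Sum>\<^sub>\<infinity>k\<in>{n..}. ennreal (a k / real (k + 1) powr (1 - t)))"
    for t and n :: nat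
  have S0: "0 \<le> S t n N" if "1 \<le> n" for t n N
    unfolding S_def using a that by (intro mult_nonneg_nonneg sum_nonneg divide_nonneg_nonneg) auto
  have lim: "(\<lambda>N. ennreal (S t n N)) \<longlonglongrightarrow> T t n" if "1 \<le> n" for t n
  proof -
    have "(\<lambda>N. ennreal (real n powr (- t)) * ennreal (\<Sum>k=n..N. a k / real (k + 1) powr (1 - t))) \<longlonglongrightarrow> T t n"
      unfolding T_def using a that
      by (intro ennreal_tendsto_cmult infsum_atLeast_ennreal_tendsto) auto
    then show ?thesis
      by (simp add: S_def ennreal_mult')
  qed
  have ST: "ennreal (S t n N powr p) \<le> ennpowr (T t n) p" if "1 \<le> n" for t n N
  proof -
    have "incseq (\<lambda>N. ennreal (S t n N))"
      unfolding S_def using a that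
      by (intro incseq_SucI ennreal_leI mult_left_mono sum_mono2) auto
    from incseq_le[OF this lim[OF that]] show ?thesis
      using ennpowr_mono[OF p(1), of "ennreal (S t n N)" "T t n"] S0[OF that] by simp
  qed
  have part: "(\<Sum>n=1..N. ennpowr (T s n) p) \<le> copson_sum p s a" for N
    unfolding copson_sum_def T_def[symmetric]
    by (subst nonneg_infsum_complete) (auto intro!: SUP_upper)
  have fin: "(\<Sum>n=1..N. ennreal (S r n N powr p)) \<le> ennreal C * copson_sum p s a" for N
  proof -
    have "(\<Sum>n=1..N. ennreal (S r n N powr p)) = ennreal (\<Sum>n=1..N. S r n N powr p)"
      by (simp add: sum_ennreal)
    also have "\<dots> \<le> ennreal (C * (\<Sum>n=1..N. S s n N powr p))"
      unfolding S_def using copson_finite[OF p \<open>s \<le> r\<close> a C, where N = N] by (intro ennreal_leI) simp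
    also have "\<dots> = ennreal C * (\<Sum>n=1..N. ennreal (S s n N powr p))"
      using \<open>0 \<le> C\<close> by (simp add: ennreal_mult sum_nonneg sum_ennreal)
    also have "\<dots> \<le> ennreal C * (\<Sum>n=1..N. ennpowr (T s n) p)"
      by (intro mult_left_mono sum_mono ST) auto
    also have "\<dots> \<le> ennreal C * copson_sum p s a"
      by (intro mult_left_mono part) simp
    finally show ?thesis .
  qed
  show ?thesis
    unfolding copson_sum_def[of p r] T_def[symmetric]
  proof (rule infsum_le_finite_sums[OF nonneg_summable_on_complete])
    fix F :: "nat set" assume F: "finite F" "F \<subseteq> {1..}"
    have "(\<lambda>N. \<Sum>n\<in>F. ennreal (S r n N powr p)) \<longlonglongrightarrow> (\<Sum>n\<in>F. ennpowr (T r n) p)"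
      using F S0 p by (intro tendsto_sum tendsto_ennpowr lim) auto
    moreover have "\<forall>\<^sub>F N in sequentially. (\<Sum>n\<in>F. ennreal (S r n N powr p)) \<le> ennreal C * copson_sum p s a"
    proof (rule eventually_sequentiallyI)
      fix N assume "Max F \<le> N"
      then have "F \<subseteq> {1..N}"
        using F by (auto simp: subset_iff dest: Max_ge[of F] order_trans)
      then have "(\<Sum>n\<in>F. ennreal (S r n N powr p)) \<le> (\<Sum>n=1..N. ennreal (S r n N powr p))"
        by (intro sum_mono2) auto
      then show "(\<Sum>n\<in>F. ennreal (S r n N powr p)) \<le> ennreal C * copson_sum p s a"
        using fin order_trans by blast
    qed
    ultimately show "(\<Sum>n\<in>F. ennpowr (T r n) p) \<le> ennreal C * copson_sum p s a"
      by (rule tendsto_upperbound) simp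
  qed simp
qed

section \<open>Sequences supported at one point\<close>

lemma copson_sum_delta:
  fixes m :: nat
  assumes "0 < p" "1 \<le> m"
  shows "copson_sum p t (\<lambda>k. if k = m then 1 else 0) =
    ennreal (real (m + 1) powr ((t - 1) * p) * (\<Sum>n=1..m. real n powr (- t * p)))"
proof -
  let ?a = "\<lambda>k. if k = m then 1 else 0 :: real"
  have inner: "(\<Sum>\<^sub>\<infinity>k\<in>{n..}. ennreal (?a k / real (k + 1) powr (1 - t)))
      = ennreal (if n \<le> m then real (m + 1) powr (t - 1) else 0)" for n
  proof -
    have "(\<Sum>\<^sub>\<infinity>k\<in>{n..}. ennreal (?a k / real (k + 1) powr (1 - t)))
        = (\<Sum>\<^sub>\<infinity>k\<in>{n..} \<inter> {m}. ennreal (?a k / real (k + 1) powr (1 - t)))"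
      by (rule infsum_cong_neutral) auto
    also have "\<dots> = ennreal (if n \<le> m then real (m + 1) powr (t - 1) else 0)"
      by (simp add: powr_diff)
    finally show ?thesis .
  qed
  have "copson_sum p t ?a = (\<Sum>\<^sub>\<infinity>n\<in>{1..m}. ennreal (real (m + 1) powr ((t - 1) * p) * real n powr (- t * p)))"
    unfolding copson_sum_def inner
  \<comment> \<open>For n > m the inner sum is 0, and so is its power because
    \<open>0 powr p = 0\<close>; the outer sum stops at m.\<close>
  proof (rule infsum_cong_neutral)
    fix n assume "n \<in> {1..} \<inter> {1..m}"
    then show "ennpowr (ennreal (real n powr (- t)) * ennreal (if n \<le> m then real (m + 1) powr (t - 1) else 0)) p
        = ennreal (real (m + 1) powr ((t - 1) * p) * real n powr (- t * p))"
      by (simp add: powr_mult powr_powr mult.commute flip: ennreal_mult)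
  qed (auto simp: ennpowr_def)
  then show ?thesis
    by (simp add: sum_ennreal sum_distrib_left)
qed

text \<open>Converse to \<open>copson_sum_le\<close>: testing with the sequence supported at m
  returns exactly the power sum condition assumed there, so the two conditions on C determine the
  same best constant.\<close>

lemma copson_lower_bound:
  assumes "0 < p" "1 \<le> m"
    and "copson_sum p r (\<lambda>k. if k = m then 1 else 0) \<le> ennreal C * copson_sum p s (\<lambda>k. if k = m then 1 else 0)"
  shows "real (m + 1) powr ((r - s) * p) * (\<Sum>n=1..m. real n powr (- r * p))
           \<le> C * (\<Sum>n=1..m. real n powr (- s * p))"
proof -
  define R where "R t = (\<Sum>n=1..m. real n powr (- t * p))" for t
  define q where "q t = real (m + 1) powr ((t - 1) * p)" for t
  have pos: "0 < R t" "0 < q t" for t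
    using \<open>1 \<le> m\<close> by (auto simp: R_def q_def intro!: sum_pos)
  have le: "ennreal (q r * R r) \<le> ennreal C * ennreal (q s * R s)"
    using assms by (simp add: copson_sum_delta R_def q_def)
  \<comment> \<open>\<open>ennreal\<close> sends negative reals to 0, so the sign of C must be
    settled before returning to real numbers.\<close>
  have "0 < C"
  proof (rule ccontr)
    assume "\<not> 0 < C"
    then have "ennreal (q r * R r) \<le> 0" using le by (simp add: ennreal_neg)
    then show False using pos[of r] by (simp add: mult_le_0_iff)
  qed
  then have "q r * R r \<le> C * (q s * R s)"
    using le pos[of s] by (simp flip: ennreal_mult add: ennreal_le_iff)
  moreover have "q r = real (m + 1) powr ((r - s) * p) * q s"
    unfolding q_def by (simp flip: powr_add add: algebra_simps)
  ultimately show ?thesis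
    using pos(2)[of s] by (simp add: R_def mult_ac)
qed

section \<open>The two parameter ranges and optimality\<close>

theorem theorem4p2:
  fixes p r s :: real
  assumes "0 < p" and "p < 1"
    and "(s < r \<and> r \<le> - (1 / p)) \<or> (0 < s \<and> s < r \<and> r < 1 / p)"
  shows "(\<forall>a :: nat \<Rightarrow> real. (\<forall>n\<ge>1. 0 \<le> a n) \<longrightarrow>
            copson_sum p r a \<le> ennreal (copson_const p r s) * copson_sum p s a)
       \<and> (\<forall>C :: real. C < copson_const p r s \<longrightarrow>
            \<not> (\<forall>a :: nat \<Rightarrow> real. (\<forall>n\<ge>1. 0 \<le> a n) \<longrightarrow>
                 copson_sum p r a \<le> ennreal C * copson_sum p s a))"
proof -
  let ?K = "copson_const p r s"
  let ?L = "\<lambda>m::nat. real (m + 1) powr ((r - s) * p) * (\<Sum>n=1..m. real n powr (- r * p))"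
  let ?R = "\<lambda>m::nat. \<Sum>n=1..m. real n powr (- s * p)"
  have "s < r" using assms(3) by auto
  \<comment> \<open>All that remains concerns power sums: \<open>?K\<close> is nonnegative and is
    the least C with \<open>?L m \<le> C * ?R m\<close> for all m \<ge> 1.\<close>
  have "0 \<le> ?K \<and> (\<forall>m\<ge>1. ?L m \<le> ?K * ?R m) \<and> (\<forall>C. (\<forall>m\<ge>1. ?L m \<le> C * ?R m) \<longrightarrow> ?K \<le> C)"
  proof (cases "r \<le> - (1 / p)")
    case True
    then have K: "?K = 2 powr ((r - s) * p)" using \<open>s < r\<close> by (simp add: copson_const_def)
    have "1 \<le> - r * p" using True assms by (simp add: field_simps)
    moreover have "- r * p \<le> - s * p" using \<open>s < r\<close> assms by simp
    ultimately have "?L m \<le> ?K * ?R m" for m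
      using power_sum_ratio_le_two_powr[of "- r * p" "- s * p" m] by (simp add: K algebra_simps)
    \<comment> \<open>At m = 1 both power sums equal 1, and the condition reads 2^((r-s)p) \<le>
      C.\<close>
    moreover have "?K \<le> C" if "\<forall>m\<ge>1. ?L m \<le> C * ?R m" for C
      using that[rule_format, of 1] by (simp add: K)
    ultimately show ?thesis by (simp add: K)
  next
    case False
    \<comment> \<open>The exponents become -rp = w - 1 and -sp = w' - 1, and the constant becomes
      w'/w.\<close>
    define w where "w = 1 - r * p"
    define w' where "w' = 1 - s * p"
    have w: "0 < w" "w < w'" "w' \<le> 1"
      using False assms \<open>s < r\<close> by (auto simp: w_def w'_def field_simps)
    have K: "?K = w' / w" using False by (simp add: copson_const_def w_def w'_def)
    have L: "?L m = (\<Sum>n=1..m. real n powr (w - 1)) * real (m + 1) powr (w' - w)"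
      and R: "?R m = (\<Sum>n=1..m. real n powr (w' - 1))" for m
      by (simp_all add: w_def w'_def algebra_simps)
    have "?L m \<le> ?K * ?R m" for m
      using normalized_sum_powr_mono[of w w' m] w unfolding L R K
      by (simp add: pos_le_divide_eq mult_ac)
    moreover have "?K \<le> C" if C: "\<forall>m\<ge>1. ?L m \<le> C * ?R m" for C
    proof -
      \<comment> \<open>The lower estimate of the sum in \<open>?L m\<close> and the upper estimate
        of \<open>?R m\<close> are compared after multiplication by (m+1)^w'. Letting m tend to
        infinity then gives w' \<le> w C.\<close>
      have bound: "w' * (1 - real (m + 1) powr (- w)) \<le> w * C" if "1 \<le> m" for m
      proof -
        have le: "?L m \<le> C * ?R m" using C that by blast
        have pos: "0 < ?L m" "0 < ?R m" using that by (auto intro!: mult_pos_pos sum_pos)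
        have "0 < C"
          using le pos by (smt (verit) mult_nonpos_nonneg)
        have "w' * (1 - real (m + 1) powr (- w)) * real (m + 1) powr w'
            = w' * (real (m + 1) powr w - 1) * real (m + 1) powr (w' - w)"
          by (simp add: algebra_simps flip: powr_add)
        also have "\<dots> \<le> w' * (w * (\<Sum>n=1..m. real n powr (w - 1))) * real (m + 1) powr (w' - w)"
          using mult_sum_powr_ge[of w m] w by (intro mult_right_mono mult_left_mono) auto
        also have "\<dots> = w' * w * ?L m" unfolding L by simp
        also have "\<dots> \<le> w' * w * (C * ?R m)"
          using le w by (intro mult_left_mono) auto
        also have "\<dots> = w * C * (w' * ?R m)" by simp
        also have "\<dots> \<le> w * C * real m powr w'"
          using mult_sum_powr_le[of w' m] w \<open>0 < C\<close> unfolding R by (intro mult_left_mono) auto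
        also have "\<dots> \<le> w * C * real (m + 1) powr w'"
          using w \<open>0 < C\<close> by (intro mult_left_mono powr_mono2) auto
        finally show ?thesis by simp
      qed
      have "(\<lambda>m. w' * (1 - real (m + 1) powr (- w))) \<longlonglongrightarrow> w' * (1 - 0)"
        using w by (intro tendsto_intros tendsto_neg_powr filterlim_compose[OF filterlim_real_sequentially]
            filterlim_add_const_nat_at_top) auto
      then have "w' * (1 - 0) \<le> w * C"
        by (rule tendsto_upperbound[OF _ eventually_sequentiallyI[OF bound]]) auto
      then show ?thesis using w by (simp add: K field_simps)
    qed
    ultimately show ?thesis using w by (simp add: K)
  qed
  then have K: "0 \<le> ?K" "\<And>m. 1 \<le> m \<Longrightarrow> ?L m \<le> ?K * ?R m"
    "\<And>C. (\<And>m. 1 \<le> m \<Longrightarrow> ?L m \<le> C * ?R m) \<Longrightarrow> ?K \<le> C"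
    by blast+
  show ?thesis
  proof (intro conjI allI impI notI)
    fix a :: "nat \<Rightarrow> real" assume "\<forall>n\<ge>1. 0 \<le> a n"
    then show "copson_sum p r a \<le> ennreal ?K * copson_sum p s a"
      using assms \<open>s < r\<close> K by (intro copson_sum_le) auto
  next
    fix C assume "C < ?K"
      and all: "\<forall>a :: nat \<Rightarrow> real. (\<forall>n\<ge>1. 0 \<le> a n) \<longrightarrow> copson_sum p r a \<le> ennreal C * copson_sum p s a"
    have "?K \<le> C"
      using all \<open>0 < p\<close> by (intro K(3) copson_lower_bound) auto
    then show False using \<open>C < ?K\<close> by simp
  qed
qed

end
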